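(* For every integer $d\ge 1$ there exist a compact subset $K\subseteq\mathbb{R}^{d+1}$ and a constant $C$ such that: (i) for every $r\in[1,2]$, $K$ contains a $d$-sphere of radius $r$, i.e. there is $c\in\mathbb{R}^{d+1}$ with $\{x\in\mathbb{R}^{d+1}:|x-c|=r\}\subseteq K$; (ii) for every $\delta\in(0,1)$, $|N_\delta(K)|\le C\,|\log\delta|^{-2/d}$.
   Context: $N_\delta(S)$ denotes the $\delta$-neighbourhood of a set $S\subseteq\mathbb{R}^{d+1}$, and $|\cdot|$ applied to a set denotes Lebesgue measure (here in $\mathbb{R}^{d+1}$); $|\cdot|$ applied to a vector is the Euclidean norm. The set $K$ is a single set that does not depend on $\delta$. *)

theory Defs
  imports "HOL-Analysis.Analysis"
begin

text \<open>The neighbourhood is the open one. It is therefore Lebesgue measurable, and for bounded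
  \<open>S\<close> it has finite measure, so that \<open>measure lebesgue\<close> is its actual volume.\<close>

definition nbhd :: "real \<Rightarrow> 'a::metric_space set \<Rightarrow> 'a set" where
  "nbhd \<delta> S = {x. \<exists>y\<in>S. dist x y < \<delta>}"

end

(* Spheres through a common point with a common tangent plane there are much closer to each other
   near that point than elsewhere. Write r = 1 + sum_{j in T} 2^-j and take the centre
   c = - sum_{j in T} 2^-j w_j for unit vectors w_j: switching on the digit j replaces a sphere by one
   that is tangent to it in direction w_j. In a direction s with |s - w_(k+i)| <= C (1 + i) e for all
   i >= 0, the digits from k on move the sphere in the normal direction only by O(2^-k e^2), so that
   the 2^k choices of the first k digits leave, near w_k, 2^k pieces of volume O(2^-k e^2 e^d).
   A sequence (w_j) whose first O(e^-d) terms contain such an index k for every direction s then gives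
   volume O(e^2) at scale log(1/delta) ~ e^-d. It is obtained by joining closed walks
   through 2^-m-nets of the sphere, m = 0, 1, 2, ... *)

theory Submission
  imports Defs
begin

subsection \<open>Walks on the sphere\<close>

lemma power_diff_le:
  fixes a b :: real
  assumes "0 \<le> a" "a \<le> b"
  shows "b ^ n - a ^ n \<le> n * b ^ (n - 1) * (b - a)"
proof (induction n)
  case (Suc n)
  have "b ^ Suc n - a ^ Suc n = b * (b ^ n - a ^ n) + a ^ n * (b - a)"
    by (simp add: algebra_simps)
  also have "\<dots> \<le> b * (n * b ^ (n - 1) * (b - a)) + b ^ n * (b - a)"
    using assms by (intro add_mono mult_left_mono mult_right_mono Suc.IH power_mono) auto
  also have "\<dots> = Suc n * b ^ (Suc n - 1) * (b - a)"
    by (cases n) (simp_all add: algebra_simps)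
  finally show ?case .
qed simp

lemma measure_ball_diff_ball:
  fixes a b :: real
  assumes "0 \<le> a" "a \<le> b"
  shows "measure lebesgue (ball (0::'a::euclidean_space) b - ball 0 a)
           = (b ^ DIM('a) - a ^ DIM('a)) * measure lebesgue (ball (0::'a) 1)"
proof -
  have "measure lebesgue (ball (0::'a) b - ball 0 a)
      = measure lebesgue (ball (0::'a) b) - measure lebesgue (ball (0::'a) a)"
    using assms by (intro measurable_measure_Diff) auto
  then show ?thesis
    using assms content_ball_conv_unit_ball[of a "0::'a"] content_ball_conv_unit_ball[of b "0::'a"]
    by (simp add: algebra_simps)
qed

text \<open>The balls of radius \<epsilon>/2 about the points are disjoint and lie in a shell of
  thickness \<epsilon> around the sphere, whose volume is O(\<epsilon>). Counting in the shell
  rather than in a full ball saves one power of \<epsilon>: a separated set has O(\<epsilon>^-d)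
  points with d = \<open>DIM('a) - 1\<close>. This exponent decides the final rate.\<close>

lemma card_separated_le:
  fixes V :: "'a::euclidean_space set" and \<epsilon> :: real
  assumes "finite V" "V \<subseteq> sphere 0 1" "0 < \<epsilon>" "\<epsilon> \<le> 1"
    and sep: "pairwise (\<lambda>u v. \<epsilon> \<le> dist u v) V"
  shows "card V * \<epsilon> ^ DIM('a) \<le> real DIM('a) * 4 ^ DIM('a) * \<epsilon>"
proof -
  define D where "D = DIM('a)"
  have D: "D \<ge> 1" by (simp add: D_def Suc_leI)
  define \<beta> where "\<beta> = measure lebesgue (ball (0::'a) 1)"
  have \<beta>: "\<beta> > 0" by (simp add: \<beta>_def content_ball_pos)
  have disj: "ball u (\<epsilon>/2) \<inter> ball v (\<epsilon>/2) = {}" if "u \<in> V" "v \<in> V" "u \<noteq> v" for u v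
  proof -
    have "\<epsilon> \<le> dist u v" using sep that by (auto simp: pairwise_def)
    then show ?thesis
      by (intro disjoint_ballI) simp
  qed
  have "measure lebesgue (\<Union>v\<in>V. ball v (\<epsilon>/2)) = (\<Sum>v\<in>V. measure lebesgue (ball v (\<epsilon>/2)))"
    using assms disj by (intro measure_UNION') (auto simp: pairwise_def disjnt_def)
  also have "\<dots> = card V * ((\<epsilon>/2) ^ D * \<beta>)"
    using content_ball_conv_unit_ball[where 'a='a, of "\<epsilon>/2"] \<open>0 < \<epsilon>\<close>
    by (simp add: D_def \<beta>_def)
  finally have "card V * ((\<epsilon>/2) ^ D * \<beta>) = measure lebesgue (\<Union>v\<in>V. ball v (\<epsilon>/2))" ..
  also have "\<dots> \<le> measure lebesgue (ball (0::'a) (1 + \<epsilon>/2) - ball 0 (1 - \<epsilon>/2))"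
  proof (rule measure_mono_fmeasurable)
    show "(\<Union>v\<in>V. ball v (\<epsilon>/2)) \<subseteq> ball (0::'a) (1 + \<epsilon>/2) - ball 0 (1 - \<epsilon>/2)"
    proof
      fix x assume "x \<in> (\<Union>v\<in>V. ball v (\<epsilon>/2))"
      then obtain v where "v \<in> V" "dist v x < \<epsilon>/2" by auto
      moreover from \<open>v \<in> V\<close> have "norm v = 1" using assms(2) by auto
      moreover have "\<bar>norm v - norm x\<bar> \<le> dist v x" by (metis dist_norm norm_triangle_ineq3)
      ultimately show "x \<in> ball 0 (1 + \<epsilon>/2) - ball 0 (1 - \<epsilon>/2)" by auto
    qed
  qed (use \<open>finite V\<close> in \<open>auto intro!: sets.finite_UN\<close>)
  also have "\<dots> = ((1 + \<epsilon>/2) ^ D - (1 - \<epsilon>/2) ^ D) * \<beta>"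
    using assms measure_ball_diff_ball[where 'a='a, of "1 - \<epsilon>/2" "1 + \<epsilon>/2"]
    by (simp add: D_def \<beta>_def)
  also have "\<dots> \<le> (real D * 2 ^ D * \<epsilon>) * \<beta>"
  proof (intro mult_right_mono)
    have "(1 + \<epsilon>/2) ^ D - (1 - \<epsilon>/2) ^ D \<le> real D * (1 + \<epsilon>/2) ^ (D - 1) * ((1 + \<epsilon>/2) - (1 - \<epsilon>/2))"
      using assms by (intro power_diff_le) auto
    also have "\<dots> \<le> real D * 2 ^ (D - 1) * \<epsilon>"
      using assms by (auto intro!: mult_mono power_mono)
    also have "\<dots> \<le> real D * 2 ^ D * \<epsilon>"
    proof -
      have "(2::real) ^ (D - 1) \<le> 2 ^ D" by (rule power_increasing) auto
      then have "real D * 2 ^ (D - 1) \<le> real D * 2 ^ D" by (rule mult_left_mono) simp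
      then show ?thesis by (rule mult_right_mono) (use assms in simp)
    qed
    finally show "(1 + \<epsilon>/2) ^ D - (1 - \<epsilon>/2) ^ D \<le> real D * 2 ^ D * \<epsilon>" .
  qed (use \<beta> in auto)
  finally have "card V * (\<epsilon>/2) ^ D \<le> real D * 2 ^ D * \<epsilon>"
    using \<beta> by (simp flip: mult.assoc)
  then have "card V * (\<epsilon>/2) ^ D * 2 ^ D \<le> real D * 2 ^ D * \<epsilon> * 2 ^ D"
    by (intro mult_right_mono) auto
  \<comment> \<open>One factor 2^D comes from the outer radius of the shell, the other from the
    radius \<epsilon>/2 of the small balls.\<close>
  moreover have "(4::real) ^ D = 2 ^ D * 2 ^ D"
    by (simp flip: power_mult_distrib)
  ultimately show ?thesis
    unfolding D_def[symmetric] by (simp add: power_divide field_simps)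
qed

text \<open>A separated set of maximal cardinality is a net, since a point farther than \<epsilon>
  from all its members could be added; the packing bound makes the maximum exist. The prescribed
  member \<open>e\<close> is where walks at different scales will be joined.\<close>

lemma sphere_net:
  fixes e :: "'a::euclidean_space" and \<epsilon> :: real
  assumes "norm e = 1" "0 < \<epsilon>" "\<epsilon> \<le> 1"
  obtains V where "finite V" "V \<subseteq> sphere 0 1" "e \<in> V"
    "\<And>\<sigma>. norm \<sigma> = 1 \<Longrightarrow> \<exists>v\<in>V. dist v \<sigma> \<le> \<epsilon>"
    "card V * \<epsilon> ^ DIM('a) \<le> real DIM('a) * 4 ^ DIM('a) * \<epsilon>"
proof -
  define P where "P V \<longleftrightarrow> finite V \<and> V \<subseteq> sphere 0 1 \<and> e \<in> V \<and> pairwise (\<lambda>u v. \<epsilon> \<le> dist u v) V" for V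
  define B where "B = nat \<lceil>real DIM('a) * 4 ^ DIM('a) * \<epsilon> / \<epsilon> ^ DIM('a)\<rceil>"
  have bd: "card V \<le> B" if "P V" for V
  proof -
    have "card V * \<epsilon> ^ DIM('a) \<le> real DIM('a) * 4 ^ DIM('a) * \<epsilon>"
      using that assms card_separated_le[of V \<epsilon>] by (auto simp: P_def)
    then have "card V \<le> real DIM('a) * 4 ^ DIM('a) * \<epsilon> / \<epsilon> ^ DIM('a)"
      using assms by (simp add: field_simps)
    then show ?thesis unfolding B_def by linarith
  qed
  have "P {e}" using assms by (auto simp: P_def)
  then obtain V where V: "P V" and mx: "\<And>W. P W \<Longrightarrow> card W \<le> card V"
    using ex_has_greatest_nat[of P "{e}" card "Suc B"] bd by (metis less_Suc_eq_le)
  have "\<exists>v\<in>V. dist v \<sigma> \<le> \<epsilon>" if "norm \<sigma> = 1" for \<sigma>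
  proof (rule ccontr)
    assume "\<not> ?thesis"
    then have far: "\<epsilon> < dist v \<sigma>" if "v \<in> V" for v using that by force
    then have "\<sigma> \<notin> V" using assms by force
    have "P (insert \<sigma> V)"
      using V far that unfolding P_def
      by (auto simp: pairwise_insert dist_commute less_imp_le)
    from mx[OF this] show False using \<open>\<sigma> \<notin> V\<close> V by (auto simp: P_def)
  qed
  then show ?thesis
    using that[of V] V card_separated_le[of V \<epsilon>] assms by (auto simp: P_def)
qed

text \<open>The walk grows by one vertex at a time; \<open>exit\<close> expresses that the graph of
  mutual \<open>R\<close>-steps on \<open>V\<close> is connected. The return to \<open>e\<close> is
  not stored in \<open>xs\<close> but tested through \<open>xs @ [e]\<close>, so that several such
  walks can be concatenated.\<close>

lemma closed_walk_exists:
  assumes "finite V" "e \<in> V" "R e e"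
    and exit: "\<And>W. e \<in> W \<Longrightarrow> W \<subset> V \<Longrightarrow> \<exists>w\<in>W. \<exists>v\<in>V - W. R w v \<and> R v w"
  obtains xs where "xs \<noteq> []" "hd xs = e" "set xs = V" "successively R (xs @ [e])"
    "length xs \<le> 2 * card V"
proof -
  have "\<exists>xs. xs \<noteq> [] \<and> hd xs = e \<and> set xs \<subseteq> V \<and> successively R (xs @ [e]) \<and>
      card (set xs) = n \<and> length xs \<le> 2 * n" if "1 \<le> n" "n \<le> card V" for n
    using that
  proof (induction n rule: dec_induct)
    case base
    \<comment> \<open>The loop \<open>R e e\<close> closes the walk with a single vertex.\<close>
    show ?case using assms by (intro exI[of _ "[e]"]) auto
  next
    case (step n)
    then obtain xs where xs: "xs \<noteq> []" "hd xs = e" "set xs \<subseteq> V" "successively R (xs @ [e])"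
      "card (set xs) = n" "length xs \<le> 2 * n" by auto
    have "e \<in> set xs" using xs by (metis hd_in_set)
    moreover have "set xs \<subset> V" using xs step by auto
    ultimately obtain w v where wv: "w \<in> set xs" "v \<in> V" "v \<notin> set xs" "R w v" "R v w"
      using exit[of "set xs"] by auto
    from wv(1) obtain as bs where split: "xs = as @ w # bs" by (meson split_list)
    \<comment> \<open>A detour from \<open>w\<close> to the new vertex and back adds two entries,
      whence the factor 2 in the length bound.\<close>
    define ys where "ys = as @ w # v # w # bs"
    have "successively R (ys @ [e])"
      using xs(4) wv unfolding split ys_def
      by (cases bs) (auto simp: successively_append_iff)
    moreover have "set ys = insert v (set xs)" by (auto simp: ys_def split)
    moreover have "hd ys = e" using xs(2) by (cases as) (auto simp: ys_def split)
    ultimately show ?case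
      using xs wv by (intro exI[of _ ys]) (auto simp: ys_def split)
  qed
  moreover have "card V \<ge> 1" using assms by (metis Suc_leI card_gt_0_iff empty_iff One_nat_def)
  ultimately obtain xs where xs: "xs \<noteq> []" "hd xs = e" "set xs \<subseteq> V" "successively R (xs @ [e])"
      "card (set xs) = card V" "length xs \<le> 2 * card V" by auto
  then have "set xs = V" using assms(1) by (simp add: card_subset_eq)
  with xs that show ?thesis by blast
qed

text \<open>Net points at distance at most 2\<epsilon> are joined by an edge. The resulting graph is
  connected because the sphere is, which holds from dimension 2 of the space on.\<close>

lemma sphere_walk:
  fixes e :: "'a::euclidean_space" and \<epsilon> :: real
  assumes "2 \<le> DIM('a)" "norm e = 1" "0 < \<epsilon>" "\<epsilon> \<le> 1"
  obtains xs where "xs \<noteq> []" "hd xs = e" "set xs \<subseteq> sphere 0 1"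
    "successively (\<lambda>u v. dist u v \<le> 2 * \<epsilon>) (xs @ [e])"
    "\<And>\<sigma>. norm \<sigma> = 1 \<Longrightarrow> \<exists>v\<in>set xs. dist v \<sigma> \<le> \<epsilon>"
    "length xs * \<epsilon> ^ DIM('a) \<le> 2 * real DIM('a) * 4 ^ DIM('a) * \<epsilon>"
proof -
  obtain V where V: "finite V" "V \<subseteq> sphere 0 1" "e \<in> V"
    "\<And>\<sigma>. norm \<sigma> = 1 \<Longrightarrow> \<exists>v\<in>V. dist v \<sigma> \<le> \<epsilon>"
    "card V * \<epsilon> ^ DIM('a) \<le> real DIM('a) * 4 ^ DIM('a) * \<epsilon>"
    using sphere_net[OF assms(2-4)] by metis
  have exit: "\<exists>w\<in>W. \<exists>v\<in>V - W. dist w v \<le> 2 * \<epsilon> \<and> dist v w \<le> 2 * \<epsilon>"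
    if "e \<in> W" "W \<subset> V" for W
  proof -
    \<comment> \<open>These two closed sets cover the connected sphere and both meet it, so they
      share a point. That point is within \<epsilon> of a visited vertex and of an unvisited
      one.\<close>
    let ?A = "\<Union>v\<in>W. cball v \<epsilon>" and ?B = "\<Union>v\<in>V - W. cball v \<epsilon>"
    have fin: "finite W" "finite (V - W)" using V that finite_subset by (auto simp: psubset_eq)
    have "connected (sphere (0::'a) 1)" by (rule connected_sphere[OF assms(1)])
    moreover have "closed ?A" "closed ?B" using fin by auto
    moreover have "sphere 0 1 \<subseteq> ?A \<union> ?B" using V(4) by fastforce
    moreover have "?A \<inter> sphere 0 1 \<noteq> {}"
    proof -
      have "e \<in> cball e \<epsilon>" using assms by simp
      then have "e \<in> ?A \<inter> sphere 0 1" using that(1) assms(2) by (auto intro!: bexI[of _ e])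
      then show ?thesis by blast
    qed
    moreover have "?B \<inter> sphere 0 1 \<noteq> {}"
    proof -
      obtain v where "v \<in> V - W" using \<open>W \<subset> V\<close> by auto
      moreover have "v \<in> cball v \<epsilon>" using assms by simp
      ultimately have "v \<in> ?B \<inter> sphere 0 1" using V(2) by (auto intro!: bexI[of _ v])
      then show ?thesis by blast
    qed
    ultimately have "?A \<inter> ?B \<inter> sphere 0 1 \<noteq> {}"
      using connected_closedD by metis
    then obtain x where "x \<in> ?A" "x \<in> ?B" by blast
    then obtain w v where "w \<in> W" "v \<in> V - W" "dist w x \<le> \<epsilon>" "dist v x \<le> \<epsilon>"
      by (metis UN_E mem_cball)
    moreover from this have "dist w v \<le> 2 * \<epsilon>"
      using dist_triangle2[of w v x] by linarith
    ultimately show ?thesis by (metis dist_commute)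
  qed
  obtain xs where xs: "xs \<noteq> []" "hd xs = e" "set xs = V"
    "successively (\<lambda>u v. dist u v \<le> 2 * \<epsilon>) (xs @ [e])" "length xs \<le> 2 * card V"
    using closed_walk_exists[OF V(1,3) _ exit] assms by auto
  have "length xs * \<epsilon> ^ DIM('a) \<le> (2 * card V) * \<epsilon> ^ DIM('a)"
    using xs(5) assms by (intro mult_right_mono) (auto simp flip: of_nat_mult)
  also have "\<dots> \<le> 2 * real DIM('a) * 4 ^ DIM('a) * \<epsilon>"
    using V(5) by simp
  finally show ?thesis using that xs V by auto
qed

text \<open>Closed walks through 2^-m-nets, all based at \<open>e\<close>, are concatenated. From
  block m on all steps are at most 2 * 2^-m, so after a visit near \<sigma> in block m the sequence
  drifts away at most linearly in \<open>i\<close>. The block lengths grow geometrically, so this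
  visit occurs at an index of order 2^(d m).\<close>

lemma sphere_sequence:
  assumes "1 \<le> d" "DIM('a::euclidean_space) = d + 1"
  obtains \<omega> :: "nat \<Rightarrow> 'a::euclidean_space" and A :: real where "\<And>k. norm (\<omega> k) = 1" "0 < A"
    "\<And>m \<sigma>. norm \<sigma> = 1 \<Longrightarrow>
       \<exists>k. k < A * 2 ^ (d * m) \<and> (\<forall>i. dist (\<omega> (k + i)) \<sigma> \<le> 2 * (1 + i) / 2 ^ m)"
proof -
  obtain e :: 'a where e: "norm e = 1" using vector_choose_size[of 1] by auto
  define L :: real where "L = 2 * real DIM('a) * 4 ^ DIM('a)"
  have "\<exists>xs. xs \<noteq> [] \<and> hd xs = e \<and> set xs \<subseteq> sphere 0 1 \<and>
    successively (\<lambda>u v. dist u v \<le> 2 * (1/2^m)) (xs @ [e]) \<and>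
    (\<forall>\<sigma>. norm \<sigma> = 1 \<longrightarrow> (\<exists>v\<in>set xs. dist v \<sigma> \<le> 1/2^m)) \<and>
    length xs \<le> L * 2 ^ (d * m)" for m :: nat
  proof -
    obtain xs where xs: "xs \<noteq> []" "hd xs = e" "set xs \<subseteq> sphere 0 1"
    "successively (\<lambda>u v. dist u v \<le> 2 * (1/2^m)) (xs @ [e])"
    "\<And>\<sigma>. norm \<sigma> = 1 \<Longrightarrow> \<exists>v\<in>set xs. dist v \<sigma> \<le> 1/2^m"
    "length xs * (1/2^m) ^ DIM('a) \<le> 2 * real DIM('a) * 4 ^ DIM('a) * (1/2^m)"
      using sphere_walk[of e "1/2^m"] assms e by (auto simp: field_simps)
    have "length xs * (1/2^m) ^ d * (1/2^m) \<le> L * (1/2^m)"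
      using xs(6) by (simp add: assms(2) L_def mult_ac)
    then have "length xs * (1/2^m) ^ d \<le> L" by (simp add: divide_right_mono field_simps)
    then have "length xs \<le> L * 2 ^ (d * m)"
      by (simp add: power_divide field_simps flip: power_mult)
    then show ?thesis using xs by blast
  qed
  then obtain W where W: "\<And>m. W m \<noteq> []" "\<And>m. hd (W m) = e" "\<And>m. set (W m) \<subseteq> sphere 0 1"
    "\<And>m. successively (\<lambda>u v. dist u v \<le> 2 * (1/2^m)) (W m @ [e])"
    "\<And>m \<sigma>. norm \<sigma> = 1 \<Longrightarrow> \<exists>v\<in>set (W m). dist v \<sigma> \<le> 1/2^m"
    "\<And>m. length (W m) \<le> L * 2 ^ (d * m)"
    by metis
  define P where "P m = concat (map W [0..<m])" for m
  have P_Suc: "P (Suc m) = P m @ W m" for m by (simp add: P_def)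
  have len_mono: "length (P m) < length (P (Suc m))" for m
    using W(1)[of m] by (simp add: P_Suc)
  have len_mono': "length (P m) \<le> length (P n)" if "m \<le> n" for m n
    using len_mono that by (rule lift_Suc_mono_le[OF less_imp_le])
  have len_ge: "m \<le> length (P m)" for m
    using len_mono by (induction m) (auto simp: Suc_le_eq intro: le_less_trans)
  have len_le: "length (P m) \<le> L * 2 ^ (d * m)" for m
  proof (induction m)
    case (Suc m)
    have "length (P (Suc m)) \<le> L * 2 ^ (d * m) + L * 2 ^ (d * m)"
      using Suc W(6)[of m] by (simp add: P_Suc)
    also have "\<dots> = L * 2 ^ (d * m + 1)" by simp
    \<comment> \<open>As d >= 1, the doubling caused by the new walk is absorbed by 2^d.\<close>
    also have "\<dots> \<le> L * 2 ^ (d * Suc m)"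
      using assms by (intro mult_left_mono power_increasing) (auto simp: L_def)
    finally show ?case .
  qed (simp add: P_def L_def)
  have prefix: "P n ! k = P m ! k" if "m \<le> n" "k < length (P m)" for m n k
    using that
  proof (induction n rule: dec_induct)
    case (step n)
    have "k < length (P n)"
      using step len_mono'[of m n] by linarith
    with step show ?case by (simp add: P_Suc nth_append)
  qed simp
  \<comment> \<open>No walk is empty, so \<open>P (Suc k)\<close> has more than \<open>k\<close>
    entries; by \<open>prefix\<close>, every \<open>P m\<close> longer than \<open>k\<close> has the
    same entry there.\<close>
  define \<omega> where "\<omega> k = P (Suc k) ! k" for k
  have \<omega>: "\<omega> k = P m ! k" if "k < length (P m)" for m k
  proof -
    have "k < length (P (Suc k))" using len_ge[of "Suc k"] by simp
    then show ?thesis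
      using that prefix[of m "Suc k" k] prefix[of "Suc k" m k] unfolding \<omega>_def
      by (cases "m \<le> Suc k") auto
  qed
  have P_set: "set (P m) \<subseteq> sphere 0 1" for m using W(3) by (auto simp: P_def)
  have norm: "norm (\<omega> k) = 1" for k
  proof -
    have "k < length (P (Suc k))" using len_ge[of "Suc k"] by simp
    then have "\<omega> k \<in> set (P (Suc k))" by (simp add: \<omega>_def)
    then show ?thesis using P_set by fastforce
  qed
  have step: "dist (\<omega> k) (\<omega> (Suc k)) \<le> 2 / 2 ^ m" if "length (P m) \<le> k" for k m
  proof -
    \<comment> \<open>The block \<open>W j\<close> is the one that contains position
      \<open>k\<close>.\<close>
    define j where "j = (LEAST j. k < length (P (Suc j)))"
    have ex: "k < length (P (Suc k))" using len_ge[of "Suc k"] by simp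
    have j1: "k < length (P (Suc j))" unfolding j_def by (rule LeastI, rule ex)
    have j2: "length (P j) \<le> k"
    proof (cases j)
      case (Suc i)
      then show ?thesis using not_less_Least[of i "\<lambda>j. k < length (P (Suc j))"]
        unfolding j_def[symmetric] by auto
    qed (simp add: P_def)
    have "m \<le> j"
    proof (rule ccontr)
      assume "\<not> m \<le> j"
      then have "length (P (Suc j)) \<le> length (P m)"
        by (intro len_mono') simp
      with j1 that show False by simp
    qed
    define i where "i = k - length (P j)"
    have k: "k = length (P j) + i" and i: "i < length (W j)"
      using j1 j2 by (auto simp: i_def P_Suc)
    \<comment> \<open>The last entry of \<open>W j\<close> is followed by the head of
      \<open>W (Suc j)\<close>, which is \<open>e\<close>. Hence both points are consecutive entries
      of \<open>W j @ [e]\<close>, even across a block boundary.\<close>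
    define Q where "Q = W j @ [e]"
    have P2: "P (Suc (Suc j)) = P j @ W j @ W (Suc j)" by (simp add: P_Suc)
    have k2: "Suc k < length (P (Suc (Suc j)))"
      using j1 len_mono[of "Suc j"] by linarith
    have "\<omega> k = Q ! i"
      using \<omega>[OF j1] i by (simp add: P_Suc k Q_def nth_append)
    moreover have "\<omega> (Suc k) = Q ! Suc i"
    proof (cases "Suc i < length (W j)")
      case True
      then show ?thesis using \<omega>[OF k2] by (simp add: P2 k Q_def nth_append)
    next
      case False
      then have "Suc i = length (W j)" using i by simp
      then show ?thesis using \<omega>[OF k2] W(1,2)[of "Suc j"]
        by (simp add: P2 k Q_def nth_append hd_conv_nth)
    qed
    moreover have "dist (Q ! i) (Q ! Suc i) \<le> 2 * (1/2^j)"
      using W(4)[of j] i unfolding Q_def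
      by (intro successively_nth[where P="\<lambda>u v. dist u v \<le> 2 * (1/2^j)"]) auto
    moreover have "(2::real) * (1/2^j) \<le> 2 / 2^m"
      using \<open>m \<le> j\<close> by (simp add: frac_le)
    ultimately show ?thesis by simp
  qed
  show ?thesis
  proof
    show "norm (\<omega> k) = 1" for k by (rule norm)
    \<comment> \<open>The visit lies before the end of block m, that is before L * 2^(d (m + 1));
      the surplus 2^d goes into the constant.\<close>
    show "0 < L * 2 ^ d" by (simp add: L_def)
    fix m \<sigma> assume "norm (\<sigma>::'a) = 1"
    then obtain v where v: "v \<in> set (W m)" "dist v \<sigma> \<le> 1/2^m" using W(5) by blast
    then obtain i where i: "i < length (W m)" "W m ! i = v" by (auto simp: in_set_conv_nth)
    define k where "k = length (P m) + i"
    have k: "k < length (P (Suc m))" using i by (simp add: k_def P_Suc)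
    have \<omega>k: "\<omega> k = v" using \<omega>[OF k] i by (simp add: P_Suc k_def)
    have "dist (\<omega> (k + n)) v \<le> n * (2 / 2 ^ m)" for n
    proof (induction n)
      case (Suc n)
      have "dist (\<omega> (k + n)) (\<omega> (Suc (k + n))) \<le> 2 / 2 ^ m"
        by (rule step) (simp add: k_def)
      then show ?case
        using Suc dist_triangle[of "\<omega> (Suc (k + n))" v "\<omega> (k + n)"]
        by (simp add: dist_commute algebra_simps add_divide_distrib)
    qed (simp add: \<omega>k)
    then have "dist (\<omega> (k + n)) \<sigma> \<le> n * (2 / 2 ^ m) + 1 / 2 ^ m" for n
      using v(2) dist_triangle[of "\<omega> (k + n)" \<sigma> v] by (meson add_mono order_trans)
    moreover have "n * (2 / 2 ^ m) + 1 / 2 ^ m \<le> 2 * (1 + real n) / 2 ^ m" for n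
      by (simp add: field_simps)
    ultimately have "dist (\<omega> (k + n)) \<sigma> \<le> 2 * (1 + n) / 2 ^ m" for n
      by (meson order_trans)
    moreover have "k < L * 2 ^ d * 2 ^ (d * m)"
      using k len_le[of "Suc m"] by (simp add: power_add mult_ac)
    ultimately show "\<exists>k. k < L * 2 ^ d * 2 ^ (d * m) \<and>
        (\<forall>i. dist (\<omega> (k + i)) \<sigma> \<le> 2 * (1 + i) / 2 ^ m)" by blast
  qed
qed

subsection \<open>Volume of a cap of a spherical shell\<close>

lemma ball_cone_measure_scale:
  fixes G :: "'a::euclidean_space set"
  assumes G: "\<And>c x. c > 0 \<Longrightarrow> x \<in> G \<Longrightarrow> c *\<^sub>R x \<in> G" and "0 \<le> s"
  shows "measure lebesgue (G \<inter> ball 0 s) = s ^ DIM('a) * measure lebesgue (G \<inter> ball 0 1)"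
proof (cases "s = 0")
  case False
  with \<open>0 \<le> s\<close> have s: "s > 0" by simp
  have "G \<inter> ball 0 s = (*\<^sub>R) s ` (G \<inter> ball 0 1)"
  proof
    show "G \<inter> ball 0 s \<subseteq> (*\<^sub>R) s ` (G \<inter> ball 0 1)"
    proof
      fix x assume x: "x \<in> G \<inter> ball 0 s"
      then have "(1/s) *\<^sub>R x \<in> G \<inter> ball 0 1"
        using s G[of "1/s" x] by simp
      moreover have "x = s *\<^sub>R ((1/s) *\<^sub>R x)" using s by simp
      ultimately show "x \<in> (*\<^sub>R) s ` (G \<inter> ball 0 1)" by (rule rev_image_eqI)
    qed
  qed (use s G in auto)
  then show ?thesis
    using measure_lebesgue_affine[of s 0 "G \<inter> ball 0 1"] s by simp
qed simp

lemma measure_cone_shell: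
  fixes G :: "'a::euclidean_space set"
  assumes G: "\<And>c x. c > 0 \<Longrightarrow> x \<in> G \<Longrightarrow> c *\<^sub>R x \<in> G" and "G \<in> sets lebesgue"
    and "0 \<le> a" "a \<le> b"
  shows "measure lebesgue (G \<inter> (ball 0 b - ball 0 a))
           = (b ^ DIM('a) - a ^ DIM('a)) * measure lebesgue (G \<inter> ball 0 1)"
proof -
  have m: "G \<inter> ball 0 s \<in> lmeasurable" for s
    using assms by (metis fmeasurable_Int_fmeasurable inf_commute lmeasurable_ball)
  have "G \<inter> (ball 0 b - ball 0 a) = (G \<inter> ball 0 b) - (G \<inter> ball 0 a)" by auto
  then have "measure lebesgue (G \<inter> (ball 0 b - ball 0 a))
      = measure lebesgue (G \<inter> ball 0 b) - measure lebesgue (G \<inter> ball 0 a)"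
    using assms m by (auto intro!: measurable_measure_Diff fmeasurableD)
  then show ?thesis
    using assms ball_cone_measure_scale[of G a] ball_cone_measure_scale[of G b]
    by (simp add: algebra_simps)
qed

text \<open>The model of one piece of the neighbourhood, with the centre of its sphere moved to the
  origin: \<rho> bounds the normal error and \<eta> the distance from the sphere point in direction
  \<open>w\<close>. It is applied with \<rho> of order 2^-k \<epsilon>^2 and \<eta> of order
  \<epsilon>.\<close>

definition shell_cap :: "real \<Rightarrow> real \<Rightarrow> real \<Rightarrow> 'a::euclidean_space \<Rightarrow> 'a set" where
  "shell_cap r \<rho> \<eta> w = {z. \<bar>norm z - r\<bar> \<le> \<rho> \<and> norm (z - r *\<^sub>R w) \<le> \<eta>}"

lemma closed_shell_cap: "closed (shell_cap r \<rho> \<eta> w)"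
  unfolding shell_cap_def by (intro closed_Collect_conj closed_Collect_le continuous_intros)

lemma compact_shell_cap: "compact (shell_cap r \<rho> \<eta> w)"
proof -
  have "shell_cap r \<rho> \<eta> w \<subseteq> cball (r *\<^sub>R w) \<eta>"
    by (auto simp: shell_cap_def dist_norm norm_minus_commute)
  then show ?thesis
    using closed_shell_cap compact_eq_bounded_closed bounded_cball bounded_subset by blast
qed

text \<open>The cone over the directions within 2\<eta> of \<open>w\<close>. The inequality is
  multiplied through by \<open>norm z\<close>, which makes the set visibly closed and invariant
  under dilations.\<close>

definition cap_cone :: "real \<Rightarrow> 'a::euclidean_space \<Rightarrow> 'a set" where
  "cap_cone \<eta> w = {z. norm (z - norm z *\<^sub>R w) \<le> 2 * \<eta> * norm z}"

lemma cap_cone_scaleR: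
  assumes "c > 0" "z \<in> cap_cone \<eta> w"
  shows "c *\<^sub>R z \<in> cap_cone \<eta> w"
proof -
  have "c *\<^sub>R z - norm (c *\<^sub>R z) *\<^sub>R w = c *\<^sub>R (z - norm z *\<^sub>R w)"
    using assms by (simp add: algebra_simps)
  then have "norm (c *\<^sub>R z - norm (c *\<^sub>R z) *\<^sub>R w) = c * norm (z - norm z *\<^sub>R w)"
    using assms by simp
  then show ?thesis using assms by (simp add: cap_cone_def)
qed

lemma sets_cap_cone: "cap_cone \<eta> w \<in> sets lebesgue"
proof -
  have "closed (cap_cone \<eta> w)"
    unfolding cap_cone_def by (intro closed_Collect_le continuous_intros)
  then show ?thesis by (simp add: borel_closed)
qed

text \<open>By homogeneity, the outer shell of thickness \<eta> carries at least the fraction \<eta>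
  of the cone in the unit ball. That part lies in a ball of radius 3\<eta> about \<open>w\<close>,
  so dividing its volume by \<eta> gives the exponent \<open>DIM('a) - 1\<close>. For \<eta> > 1 the
  whole unit ball is a sufficient bound.\<close>

lemma measure_cap_cone_le:
  fixes w :: "'a::euclidean_space"
  assumes w: "norm w = 1" and \<eta>: "0 < \<eta>"
  shows "measure lebesgue (cap_cone \<eta> w \<inter> ball 0 1)
           \<le> 3 ^ DIM('a) * \<eta> ^ (DIM('a) - 1) * measure lebesgue (ball (0::'a) 1)"
proof (cases "\<eta> \<le> 1")
  case True
  define D where "D = DIM('a)"
  have D: "D \<ge> 1" by (simp add: D_def Suc_leI)
  define \<mu> where "\<mu> = measure lebesgue (cap_cone \<eta> w \<inter> ball 0 1)"
  have "\<eta> * \<mu> \<le> (1 ^ D - (1 - \<eta>) ^ D) * \<mu>"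
  proof (rule mult_right_mono)
    have "(1 - \<eta>) ^ D \<le> (1 - \<eta>) ^ 1"
      using \<eta> True D by (intro power_decreasing) auto
    then show "\<eta> \<le> 1 ^ D - (1 - \<eta>) ^ D" by simp
  qed (simp add: \<mu>_def)
  also have "\<dots> = measure lebesgue (cap_cone \<eta> w \<inter> (ball 0 1 - ball 0 (1 - \<eta>)))"
    unfolding D_def \<mu>_def
    by (rule measure_cone_shell[symmetric]) (use \<eta> True cap_cone_scaleR sets_cap_cone in auto)
  also have "\<dots> \<le> measure lebesgue (cball w (3 * \<eta>))"
  proof (rule measure_mono_fmeasurable)
    show "cap_cone \<eta> w \<inter> (ball 0 1 - ball 0 (1 - \<eta>)) \<subseteq> cball w (3 * \<eta>)"
    proof
      fix z assume "z \<in> cap_cone \<eta> w \<inter> (ball 0 1 - ball 0 (1 - \<eta>))"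
      then have z: "norm (z - norm z *\<^sub>R w) \<le> 2 * \<eta> * norm z" "norm z < 1" "1 - \<eta> \<le> norm z"
        by (auto simp: cap_cone_def)
      \<comment> \<open>The aperture contributes 2\<eta> and the thickness of the shell
        \<eta>.\<close>
      have "w - z = - (z - norm z *\<^sub>R w) + (1 - norm z) *\<^sub>R w" by (simp add: algebra_simps)
      then have "norm (w - z) \<le> norm (z - norm z *\<^sub>R w) + norm ((1 - norm z) *\<^sub>R w)"
        by (metis norm_minus_cancel norm_triangle_ineq)
      also have "\<dots> \<le> 2 * \<eta> * 1 + \<eta>"
      proof (rule add_mono)
        have "2 * \<eta> * norm z \<le> 2 * \<eta> * 1" using z(2) \<eta> by (intro mult_left_mono) auto
        with z(1) show "norm (z - norm z *\<^sub>R w) \<le> 2 * \<eta> * 1" by linarith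
      qed (use z w in auto)
      finally show "z \<in> cball w (3 * \<eta>)" by (simp add: dist_norm)
    qed
  qed (auto intro!: sets.Int sets_cap_cone)
  also have "\<dots> = (3 * \<eta>) ^ D * measure lebesgue (ball (0::'a) 1)"
    using \<eta> content_ball_conv_unit_ball[of "3 * \<eta>" w]
    by (simp add: content_cball_conv_ball D_def)
  also have "\<dots> = \<eta> * (3 ^ D * \<eta> ^ (D - 1) * measure lebesgue (ball (0::'a) 1))"
    using D by (cases D) (simp_all add: power_mult_distrib)
  finally show ?thesis using \<eta> by (simp add: D_def \<mu>_def)
next
  case False
  have "measure lebesgue (cap_cone \<eta> w \<inter> ball 0 1) \<le> 1 * 1 * measure lebesgue (ball (0::'a) 1)"
    by (auto intro!: measure_mono_fmeasurable sets.Int sets_cap_cone simp del: measure_completion)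
  also have "\<dots> \<le> 3 ^ DIM('a) * \<eta> ^ (DIM('a) - 1) * measure lebesgue (ball (0::'a) 1)"
    using False by (intro mult_right_mono mult_mono) auto
  finally show ?thesis .
qed

text \<open>The cap lies in a cone over directions near \<open>w\<close>, cut by a shell of
  thickness at most 3\<rho>. The volume of such a set is the cone volume times a difference of
  powers of the two radii.\<close>

lemma measure_shell_cap_le:
  fixes w :: "'a::euclidean_space"
  assumes w: "norm w = 1" and r: "1 \<le> r" and \<rho>: "0 < \<rho>" "\<rho> \<le> \<eta>" and R: "r + 2 * \<rho> \<le> R"
  shows "measure lebesgue (shell_cap r \<rho> \<eta> w)
     \<le> 3 * real DIM('a) * R ^ (DIM('a) - 1) * 3 ^ DIM('a) * measure lebesgue (ball (0::'a) 1)
         * (\<rho> * \<eta> ^ (DIM('a) - 1))"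
proof -
  define D where "D = DIM('a)"
  \<comment> \<open>The maximum is taken because \<rho> may exceed r. The outer radius is r +
    2\<rho> rather than r + \<rho>, so that the closed cap fits in the open ball.\<close>
  define a where "a = max 0 (r - \<rho>)"
  define b where "b = r + 2 * \<rho>"
  have ab: "0 \<le> a" "a \<le> b" "b - a \<le> 3 * \<rho>" using r \<rho> by (auto simp: a_def b_def)
  have "measure lebesgue (shell_cap r \<rho> \<eta> w) \<le> measure lebesgue (cap_cone \<eta> w \<inter> (ball 0 b - ball 0 a))"
  proof (rule measure_mono_fmeasurable)
    show "shell_cap r \<rho> \<eta> w \<subseteq> cap_cone \<eta> w \<inter> (ball 0 b - ball 0 a)"
    proof
      fix z assume "z \<in> shell_cap r \<rho> \<eta> w"
      then have z: "\<bar>norm z - r\<bar> \<le> \<rho>" "norm (z - r *\<^sub>R w) \<le> \<eta>" by (auto simp: shell_cap_def)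
      \<comment> \<open>The deviation of the direction of \<open>z\<close> from \<open>w\<close> is
        split into a radial error and the distance to the base point of the cap, each at most \<eta>
        times \<open>norm z\<close>.\<close>
      have "r *\<^sub>R (z - norm z *\<^sub>R w) = (r - norm z) *\<^sub>R z + norm z *\<^sub>R (z - r *\<^sub>R w)"
        by (simp add: algebra_simps)
      then have "norm (r *\<^sub>R (z - norm z *\<^sub>R w))
          \<le> norm ((r - norm z) *\<^sub>R z) + norm (norm z *\<^sub>R (z - r *\<^sub>R w))"
        by (metis norm_triangle_ineq)
      also have "\<dots> \<le> \<eta> * norm z + norm z * \<eta>"
        unfolding norm_scaleR abs_norm_cancel
        using z \<rho> by (intro add_mono mult_right_mono mult_left_mono) auto
      finally have "r * norm (z - norm z *\<^sub>R w) \<le> 2 * \<eta> * norm z" using r by simp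
      moreover have "1 * norm (z - norm z *\<^sub>R w) \<le> r * norm (z - norm z *\<^sub>R w)"
        using r by (intro mult_right_mono) auto
      moreover have "a \<le> norm z" "norm z < b" using z(1) \<rho> by (auto simp: a_def b_def)
      ultimately show "z \<in> cap_cone \<eta> w \<inter> (ball 0 b - ball 0 a)"
        by (auto simp: cap_cone_def)
    qed
    show "cap_cone \<eta> w \<inter> (ball 0 b - ball 0 a) \<in> lmeasurable"
      using sets_cap_cone by (metis fmeasurable_Int_fmeasurable inf_commute lmeasurable_ball fmeasurable.Diff)
  qed (simp add: borel_closed closed_shell_cap)
  also have "\<dots> = (b ^ D - a ^ D) * measure lebesgue (cap_cone \<eta> w \<inter> ball 0 1)"
    unfolding D_def by (rule measure_cone_shell[OF cap_cone_scaleR sets_cap_cone ab(1,2)])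
  also have "\<dots> \<le> (real D * R ^ (D - 1) * (3 * \<rho>))
      * (3 ^ D * \<eta> ^ (D - 1) * measure lebesgue (ball (0::'a) 1))"
  proof (rule mult_mono)
    have "b ^ D - a ^ D \<le> real D * b ^ (D - 1) * (b - a)" by (rule power_diff_le[OF ab(1,2)])
    also have "\<dots> \<le> real D * R ^ (D - 1) * (3 * \<rho>)"
      using ab R r \<rho> by (intro mult_mono power_mono) (auto simp: b_def)
    finally show "b ^ D - a ^ D \<le> real D * R ^ (D - 1) * (3 * \<rho>)" .
    show "measure lebesgue (cap_cone \<eta> w \<inter> ball 0 1)
        \<le> 3 ^ D * \<eta> ^ (D - 1) * measure lebesgue (ball (0::'a) 1)"
      using measure_cap_cone_le[OF w, of \<eta>] \<rho> by (simp add: D_def)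
  qed (use R r \<rho> in auto)
  finally show ?thesis by (simp add: D_def mult_ac)
qed

subsection \<open>Spheres indexed by binary expansions\<close>

definition dyad :: "nat set \<Rightarrow> nat \<Rightarrow> real" where
  "dyad T j = (if j \<in> T then 1 / 2 ^ j else 0)"

definition rad :: "nat set \<Rightarrow> real" where
  "rad T = 1 + (\<Sum>j. dyad T j)"

text \<open>The shift by -2^-j \<open>\<omega> j\<close> accompanies the growth of the radius by
  2^-j: the point in direction \<sigma> moves by 2^-j (\<sigma> - \<open>\<omega> j\<close>). This
  vanishes for \<sigma> = \<open>\<omega> j\<close>, where the two spheres therefore touch from
  inside.\<close>

definition ctr :: "(nat \<Rightarrow> 'a::euclidean_space) \<Rightarrow> nat set \<Rightarrow> 'a" where
  "ctr \<omega> T = - (\<Sum>j. dyad T j *\<^sub>R \<omega> j)"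

lemma dyad_bounds: "0 \<le> dyad T j" "dyad T j \<le> (1/2) ^ j"
  by (auto simp: dyad_def power_one_over)

lemma summable_dyad: "summable (dyad T)"
  by (rule summable_comparison_test'[where g="\<lambda>j. (1/2) ^ j" and N=0])
    (use dyad_bounds in \<open>auto intro: summable_geometric\<close>)

lemma norm_dyad_scaleR_le:
  assumes "norm (v j) \<le> b"
  shows "norm (dyad T j *\<^sub>R v j) \<le> b * (1/2) ^ j"
proof -
  have "norm (dyad T j *\<^sub>R v j) = dyad T j * norm (v j)" using dyad_bounds[of T j] by simp
  also have "\<dots> \<le> (1/2) ^ j * b"
    using assms dyad_bounds[of T j] by (intro mult_mono) auto
  finally show ?thesis by (simp add: mult.commute)
qed

lemma summable_dyad_scaleR:
  fixes v :: "nat \<Rightarrow> 'a::euclidean_space"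
  assumes "\<And>j. norm (v j) \<le> b"
  shows "summable (\<lambda>j. dyad T j *\<^sub>R v j)"
proof (rule summable_comparison_test'[where g="\<lambda>j. b * (1/2) ^ j" and N=0])
  show "summable (\<lambda>j. b * (1/2) ^ j)" by (intro summable_mult summable_geometric) simp
qed (rule norm_dyad_scaleR_le[OF assms])

lemma rad_bounds: "1 \<le> rad T" "rad T \<le> 3"
proof -
  have "(\<Sum>j. dyad T j) \<le> (\<Sum>j. (1/2) ^ j)"
    using dyad_bounds summable_dyad by (intro suminf_le) (auto intro: summable_geometric)
  also have "\<dots> = 2" by (subst suminf_geometric) auto
  finally show "rad T \<le> 3" by (simp add: rad_def)
  show "1 \<le> rad T" using suminf_nonneg[OF summable_dyad dyad_bounds(1)] by (simp add: rad_def)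
qed

lemma norm_ctr_le:
  assumes "\<And>j. norm (\<omega> j) = 1"
  shows "norm (ctr \<omega> T) \<le> 2"
proof -
  have "norm (\<Sum>j. dyad T j *\<^sub>R \<omega> j) \<le> (\<Sum>j. (1/2::real) ^ j)"
    using norm_dyad_scaleR_le[of \<omega> _ 1 T] assms
    by (intro norm_suminf_le) (auto intro: summable_geometric)
  also have "\<dots> = 2" by (subst suminf_geometric) auto
  finally show ?thesis by (simp add: ctr_def)
qed

text \<open>The binary digits of \<open>s\<close> are the parities of the integer parts of 2^j s.
  The partial sums are then the truncations of \<open>s\<close>, with error at most 2^-n. As s < 2,
  the integer part of \<open>s\<close> is itself one digit, at position 0.\<close>

lemma dyad_expansion:
  assumes "0 \<le> s" "s < 2"
  obtains T where "dyad T sums s"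
proof
  define T where "T = {j. odd \<lfloor>2 ^ j * s\<rfloor>}"
  have fl: "\<lfloor>2 * x\<rfloor> = 2 * \<lfloor>x\<rfloor> + (if odd \<lfloor>2 * x\<rfloor> then 1 else 0)" for x :: real
  proof -
    have "\<lfloor>2 * x\<rfloor> = 2 * \<lfloor>x\<rfloor> \<or> \<lfloor>2 * x\<rfloor> = 2 * \<lfloor>x\<rfloor> + 1" by linarith
    then show ?thesis by auto
  qed
  have ps: "(\<Sum>j\<le>n. dyad T j) = \<lfloor>2 ^ n * s\<rfloor> / 2 ^ n" for n
  proof (induction n)
    case 0
    have "\<lfloor>s\<rfloor> = 0 \<or> \<lfloor>s\<rfloor> = 1" using assms by linarith
    then show ?case by (auto simp: dyad_def T_def)
  next
    case (Suc n)
    have "\<lfloor>2 ^ Suc n * s\<rfloor> = 2 * \<lfloor>2 ^ n * s\<rfloor> + (if Suc n \<in> T then 1 else 0)"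
      using fl[of "2 ^ n * s"] by (simp add: T_def mult.assoc)
    then show ?case using Suc by (simp add: dyad_def field_simps)
  qed
  have "(\<lambda>n. \<lfloor>2 ^ n * s\<rfloor> / 2 ^ n) \<longlonglongrightarrow> s"
  proof (rule Lim_transform2[where f="\<lambda>_. s"])
    show "(\<lambda>n. s - \<lfloor>2 ^ n * s\<rfloor> / 2 ^ n) \<longlonglongrightarrow> 0"
    proof (rule tendsto_0_le[where K=1])
      show "(\<lambda>n. (1/2::real) ^ n) \<longlonglongrightarrow> 0" by (rule LIMSEQ_power_zero) simp
      show "\<forall>\<^sub>F n in sequentially. norm (s - \<lfloor>2 ^ n * s\<rfloor> / 2 ^ n) \<le> norm ((1/2::real) ^ n) * 1"
      proof (intro always_eventually allI)
        fix n
        have "s - \<lfloor>2 ^ n * s\<rfloor> / 2 ^ n = (2 ^ n * s - \<lfloor>2 ^ n * s\<rfloor>) / 2 ^ n"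
          by (simp add: field_simps)
        moreover have "\<bar>2 ^ n * s - \<lfloor>2 ^ n * s\<rfloor>\<bar> \<le> 1" by linarith
        ultimately show "norm (s - \<lfloor>2 ^ n * s\<rfloor> / 2 ^ n) \<le> norm ((1/2::real) ^ n) * 1"
          by (simp add: power_one_over divide_right_mono)
      qed
    qed
  qed simp
  then show "dyad T sums s" by (simp add: sums_def_le ps)
qed

section \<open>Effect of the later digits near one direction\<close>

lemma summable_square_dyadic: "summable (\<lambda>i. (1 + real i)\<^sup>2 * (1/2) ^ i)"
proof (rule summable_comparison_test'[where g="\<lambda>i. 36 * (49/72) ^ i" and N=0])
  show "summable (\<lambda>i. 36 * (49/72::real) ^ i)"
    by (intro summable_mult summable_geometric) auto
  fix i :: nat
  \<comment> \<open>The base 7/6 is chosen because its square is below 2, so that the final ratio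
    49/72 is below 1.\<close>
  have "1 + i * (1/6) \<le> (1 + 1/6::real) ^ i" by (rule Bernoulli_inequality) simp
  then have "1 + real i \<le> 6 * (7/6) ^ i" by simp
  then have "(1 + real i)\<^sup>2 \<le> (6 * (7/6) ^ i)\<^sup>2" by (intro power_mono) auto
  also have "\<dots> = 36 * (49/36) ^ i"
    by (simp add: power_mult_distrib power2_eq_square flip: power_mult_distrib)
  finally have "(1 + real i)\<^sup>2 * (1/2) ^ i \<le> 36 * (49/36) ^ i * (1/2) ^ i"
    by (rule mult_right_mono) simp
  also have "\<dots> = 36 * (49/72) ^ i" by (simp flip: power_mult_distrib)
  finally show "norm ((1 + real i)\<^sup>2 * (1/2) ^ i) \<le> 36 * (49/72) ^ i" by simp
qed

text \<open>The total weight of squared linear drifts over the digits after k, relative to 2^-k. It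
  also dominates the sum with unsquared weights, so one constant serves for tangential and normal
  displacements.\<close>

definition qsum :: real where "qsum = (\<Sum>i. (1 + real i)\<^sup>2 * (1/2) ^ i)"

lemma qsum_nonneg: "0 \<le> qsum"
  unfolding qsum_def by (rule suminf_nonneg[OF summable_square_dyadic]) simp

text \<open>The point of the sphere in direction \<sigma> equals \<sigma> plus the sum of all digit
  displacements. Splitting this sum at k leaves the corresponding point for the first k digits and a
  tail.\<close>

lemma sphere_point_truncate:
  fixes \<omega> :: "nat \<Rightarrow> 'a::euclidean_space"
  assumes \<omega>: "\<And>j. norm (\<omega> j) = 1" and \<sigma>: "norm \<sigma> = 1"
  shows "ctr \<omega> T + rad T *\<^sub>R \<sigma> = ctr \<omega> (T \<inter> {..<k}) + rad (T \<inter> {..<k}) *\<^sub>R \<sigma>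
    + (\<Sum>i. dyad T (i + k) *\<^sub>R (\<sigma> - \<omega> (i + k)))"
proof -
  have bd: "norm (\<sigma> - \<omega> j) \<le> 2" for j
    using norm_triangle_ineq4[of \<sigma> "\<omega> j"] \<omega> \<sigma> by simp
  have eq: "ctr \<omega> S + rad S *\<^sub>R \<sigma> = \<sigma> + (\<Sum>j. dyad S j *\<^sub>R (\<sigma> - \<omega> j))" for S
  proof -
    have "(\<Sum>j. dyad S j *\<^sub>R (\<sigma> - \<omega> j)) = (\<Sum>j. dyad S j *\<^sub>R \<sigma>) - (\<Sum>j. dyad S j *\<^sub>R \<omega> j)"
      using summable_dyad_scaleR[of \<omega> 1 S] summable_dyad_scaleR[of "\<lambda>_. \<sigma>" 1 S] \<omega> \<sigma>
      by (simp add: suminf_diff scaleR_diff_right)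
    moreover have "(\<Sum>j. dyad S j *\<^sub>R \<sigma>) = (\<Sum>j. dyad S j) *\<^sub>R \<sigma>"
      by (rule suminf_scaleR_left[symmetric]) (rule summable_dyad)
    ultimately show ?thesis by (simp add: ctr_def rad_def algebra_simps)
  qed
  have "(\<Sum>j. dyad T j *\<^sub>R (\<sigma> - \<omega> j))
      = (\<Sum>i. dyad T (i + k) *\<^sub>R (\<sigma> - \<omega> (i + k))) + (\<Sum>j<k. dyad T j *\<^sub>R (\<sigma> - \<omega> j))"
    by (rule suminf_split_initial_segment) (rule summable_dyad_scaleR[OF bd])
  moreover have "(\<Sum>j. dyad (T \<inter> {..<k}) j *\<^sub>R (\<sigma> - \<omega> j))
      = (\<Sum>j<k. dyad (T \<inter> {..<k}) j *\<^sub>R (\<sigma> - \<omega> j))"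
    by (rule suminf_finite) (auto simp: dyad_def)
  moreover have "\<dots> = (\<Sum>j<k. dyad T j *\<^sub>R (\<sigma> - \<omega> j))"
    by (rule sum.cong) (auto simp: dyad_def)
  ultimately show ?thesis by (simp add: eq)
qed

text \<open>For unit vectors, the component of \<sigma> - v along \<sigma> is |\<sigma> - v|^2 / 2.
  The tail is therefore of first order in \<open>b\<close>, but its normal component is nonnegative
  and of second order: this is the tangency of the spheres.\<close>

lemma tail_bounds:
  fixes T :: "nat set" and \<omega> :: "nat \<Rightarrow> 'a::euclidean_space"
  assumes \<omega>: "\<And>j. norm (\<omega> j) = 1" and \<sigma>: "norm \<sigma> = 1" and "0 \<le> b"
    and near: "\<And>i. dist (\<omega> (k + i)) \<sigma> \<le> b * (1 + i)"
  defines "w \<equiv> (\<Sum>i. dyad T (i + k) *\<^sub>R (\<sigma> - \<omega> (i + k)))"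
  shows "norm w \<le> b * qsum / 2 ^ k" "0 \<le> w \<bullet> \<sigma>" "w \<bullet> \<sigma> \<le> b\<^sup>2 * qsum / 2 ^ k"
proof -
  have bd: "norm (\<sigma> - \<omega> j) \<le> 2" for j
    using norm_triangle_ineq4[of \<sigma> "\<omega> j"] \<omega> \<sigma> by simp
  have summ: "summable (\<lambda>i. dyad T (i + k) *\<^sub>R (\<sigma> - \<omega> (i + k)))"
    using summable_dyad_scaleR[OF bd] by (rule summable_ignore_initial_segment)
  have near': "norm (\<sigma> - \<omega> (i + k)) \<le> b * (1 + i)" for i
    using near[of i] by (simp add: dist_norm norm_minus_commute add.commute)
  have d: "dyad T (i + k) \<le> (1/2) ^ i / 2 ^ k" for i
    using dyad_bounds(2)[of T "i + k"] by (simp add: power_add power_one_over)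
  have q: "(\<lambda>i. c * ((1 + real i)\<^sup>2 * (1/2) ^ i)) sums (c * qsum)" for c
    unfolding qsum_def by (intro sums_mult summable_sums summable_square_dyadic)
  have "norm w \<le> (\<Sum>i. b / 2 ^ k * ((1 + real i)\<^sup>2 * (1/2) ^ i))"
    unfolding w_def
  proof (rule norm_suminf_le)
    fix i
    have "norm (dyad T (i + k) *\<^sub>R (\<sigma> - \<omega> (i + k))) \<le> (1/2) ^ i / 2 ^ k * (b * (1 + i))"
      unfolding norm_scaleR abs_of_nonneg[OF dyad_bounds(1)]
      using d[of i] near'[of i] by (intro mult_mono) auto
    \<comment> \<open>The weight 1 + i is enlarged to its square to reuse
      \<open>qsum\<close>.\<close>
    also have "\<dots> \<le> (1/2) ^ i / 2 ^ k * (b * (1 + real i)\<^sup>2)"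
      using \<open>0 \<le> b\<close> by (intro mult_left_mono) (auto simp: self_le_power)
    finally show "norm (dyad T (i + k) *\<^sub>R (\<sigma> - \<omega> (i + k)))
      \<le> b / 2 ^ k * ((1 + real i)\<^sup>2 * (1/2) ^ i)" by (simp add: mult_ac)
  qed (rule sums_summable[OF q])
  also have "\<dots> = b / 2 ^ k * qsum" by (rule sums_unique[OF q, symmetric])
  finally show "norm w \<le> b * qsum / 2 ^ k" by simp
  define h where "h i = dyad T (i + k) * ((\<sigma> - \<omega> (i + k)) \<bullet> \<sigma>)" for i
  have "(\<lambda>i. (dyad T (i + k) *\<^sub>R (\<sigma> - \<omega> (i + k))) \<bullet> \<sigma>) sums (w \<bullet> \<sigma>)"
    unfolding w_def by (intro bounded_linear.sums[OF bounded_linear_inner_left] summable_sums summ)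
  then have h: "h sums (w \<bullet> \<sigma>)" by (simp add: h_def[abs_def])
  have half: "(\<sigma> - v) \<bullet> \<sigma> = (norm (\<sigma> - v))\<^sup>2 / 2" if "norm v = 1" for v
    using that \<sigma> by (simp add: power2_norm_eq_inner inner_diff inner_commute norm_eq_1)
  have h_le: "h i \<le> b\<^sup>2 / 2 ^ k * ((1 + real i)\<^sup>2 * (1/2) ^ i)" for i
  proof -
    have "(norm (\<sigma> - \<omega> (i + k)))\<^sup>2 \<le> (b * (1 + i))\<^sup>2"
      using near' by (intro power_mono) auto
    then have "(\<sigma> - \<omega> (i + k)) \<bullet> \<sigma> \<le> (b * (1 + i))\<^sup>2"
      unfolding half[OF \<omega>] using zero_le_power2[of "norm (\<sigma> - \<omega> (i + k))"] by linarith
    moreover have "0 \<le> (\<sigma> - \<omega> (i + k)) \<bullet> \<sigma>" unfolding half[OF \<omega>] by simp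
    ultimately have "h i \<le> (1/2) ^ i / 2 ^ k * (b * (1 + i))\<^sup>2"
      unfolding h_def using mult_mono[OF d[of i]] by auto
    then show ?thesis by (simp add: power_mult_distrib mult_ac)
  qed
  show "0 \<le> w \<bullet> \<sigma>"
  proof (rule sums_le[OF _ sums_zero h])
    show "0 \<le> h i" for i using dyad_bounds(1) by (simp add: h_def half[OF \<omega>])
  qed
  have "w \<bullet> \<sigma> \<le> b\<^sup>2 / 2 ^ k * qsum" by (rule sums_le[OF h_le h q])
  then show "w \<bullet> \<sigma> \<le> b\<^sup>2 * qsum / 2 ^ k" by simp
qed

text \<open>Up to \<delta>, the point relative to the truncated centre is \<open>z\<close>, the
  truncated sphere point plus the tail \<open>w\<close>. Its norm exceeds \<open>rad F\<close> only
  by the normal part of \<open>w\<close> and by |w|^2, both O(2^-k \<epsilon>^2), while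
  \<open>z\<close> itself is within O(\<epsilon>) of the point in direction
  \<open>\<omega> k\<close>.\<close>

lemma near_sphere_in_shell_cap:
  fixes \<omega> :: "nat \<Rightarrow> 'a::euclidean_space"
  assumes \<omega>: "\<And>j. norm (\<omega> j) = 1" and \<sigma>: "norm \<sigma> = 1"
    and \<epsilon>: "0 < \<epsilon>" "\<epsilon> \<le> 1" and \<delta>: "\<delta> \<le> \<epsilon>\<^sup>2 / 2 ^ k"
    and near: "\<And>i. dist (\<omega> (k + i)) \<sigma> \<le> 2 * (1 + i) * \<epsilon>"
    and x: "dist x (ctr \<omega> T + rad T *\<^sub>R \<sigma>) < \<delta>"
  defines "F \<equiv> T \<inter> {..<k}" and "C \<equiv> 7 + 4 * qsum + 4 * qsum\<^sup>2"
  shows "x - ctr \<omega> F \<in> shell_cap (rad F) (C * \<epsilon>\<^sup>2 / 2 ^ k) (C * \<epsilon>) (\<omega> k)"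
proof -
  define w where "w = (\<Sum>i. dyad T (i + k) *\<^sub>R (\<sigma> - \<omega> (i + k)))"
  have near': "dist (\<omega> (k + i)) \<sigma> \<le> 2 * \<epsilon> * (1 + real i)" for i
    using near[of i] by (simp add: mult_ac)
  have w: "norm w \<le> (2 * \<epsilon>) * qsum / 2 ^ k" "0 \<le> w \<bullet> \<sigma>" "w \<bullet> \<sigma> \<le> (2 * \<epsilon>)\<^sup>2 * qsum / 2 ^ k"
    using tail_bounds[OF \<omega> \<sigma> _ near', of T] \<epsilon> by (simp_all add: w_def)
  define z where "z = rad F *\<^sub>R \<sigma> + w"
  have xz: "norm (x - ctr \<omega> F - z) < \<delta>"
    using x sphere_point_truncate[of \<omega> \<sigma> T k] \<omega> \<sigma>
    by (simp add: dist_norm z_def F_def w_def algebra_simps)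
  have r: "1 \<le> rad F" "rad F \<le> 3" by (rule rad_bounds)+
  have k1: "(1::real) \<le> 2 ^ k" by simp
  have nz: "(norm z)\<^sup>2 = (rad F)\<^sup>2 + 2 * rad F * (w \<bullet> \<sigma>) + (norm w)\<^sup>2"
  proof -
    have "z \<bullet> z = (rad F)\<^sup>2 * (\<sigma> \<bullet> \<sigma>) + 2 * rad F * (w \<bullet> \<sigma>) + w \<bullet> w"
      by (simp add: z_def inner_add_left inner_add_right inner_commute power2_eq_square algebra_simps)
    then show ?thesis using \<sigma> by (simp add: power2_norm_eq_inner norm_eq_1)
  qed
  have lower: "rad F \<le> norm z"
  proof (rule power2_le_imp_le)
    show "(rad F)\<^sup>2 \<le> (norm z)\<^sup>2" using nz w(2) r by simp
  qed simp
  have upper: "norm z \<le> rad F + w \<bullet> \<sigma> + (norm w)\<^sup>2"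
  proof (rule power2_le_imp_le)
    define p q where "p = w \<bullet> \<sigma>" and "q = (norm w)\<^sup>2"
    have pq: "0 \<le> p" "0 \<le> q" using w(2) by (auto simp: p_def q_def)
    \<comment> \<open>Since \<open>rad F\<close> is at least 1, the cross term 2 *
      \<open>rad F\<close> * q of the square already covers q; no square root is expanded.\<close>
    have "q \<le> rad F * q" using mult_right_mono[OF r(1) pq(2)] by simp
    moreover have "(rad F + p + q)\<^sup>2 = (rad F)\<^sup>2 + 2 * rad F * p + 2 * (rad F * q) + (p + q)\<^sup>2"
      by (simp add: power2_eq_square algebra_simps)
    ultimately have "(rad F)\<^sup>2 + 2 * rad F * p + q \<le> (rad F + p + q)\<^sup>2"
      using pq zero_le_power2[of "p + q"] by linarith
    then show "(norm z)\<^sup>2 \<le> (rad F + w \<bullet> \<sigma> + (norm w)\<^sup>2)\<^sup>2" by (simp add: nz p_def q_def)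
  qed (use r w in auto)
  have w2: "(norm w)\<^sup>2 \<le> 4 * qsum\<^sup>2 * \<epsilon>\<^sup>2 / 2 ^ k"
  proof -
    have "(norm w)\<^sup>2 \<le> ((2 * \<epsilon>) * qsum / 2 ^ k)\<^sup>2" using w(1) by (intro power_mono) auto
    also have "\<dots> = 4 * qsum\<^sup>2 * \<epsilon>\<^sup>2 / (2 ^ k * 2 ^ k)"
      by (simp add: power_mult_distrib power_divide power2_eq_square)
    also have "\<dots> \<le> 4 * qsum\<^sup>2 * \<epsilon>\<^sup>2 / (2 ^ k * 1)"
      using k1 by (intro divide_left_mono mult_left_mono) auto
    finally show ?thesis by simp
  qed
  have "norm z - rad F \<le> (4 * qsum + 4 * qsum\<^sup>2) * \<epsilon>\<^sup>2 / 2 ^ k"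
    using upper w(3) w2 by (simp add: power_mult_distrib algebra_simps add_divide_distrib)
  moreover have "\<bar>norm (x - ctr \<omega> F) - norm z\<bar> < \<delta>"
    using xz norm_triangle_ineq3[of "x - ctr \<omega> F" z] by linarith
  ultimately have "\<bar>norm (x - ctr \<omega> F) - rad F\<bar> \<le> (4 * qsum + 4 * qsum\<^sup>2) * \<epsilon>\<^sup>2 / 2 ^ k + \<epsilon>\<^sup>2 / 2 ^ k"
    using lower \<delta> by linarith
  also have "\<dots> = (1 + 4 * qsum + 4 * qsum\<^sup>2) * \<epsilon>\<^sup>2 / 2 ^ k"
    by (simp add: algebra_simps add_divide_distrib)
  \<comment> \<open>The summands of 1 + 4 \<open>qsum\<close> + 4 \<open>qsum\<close>^2 stem from
    \<delta>, the normal part of the tail, and its squared norm.\<close>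
  also have "\<dots> \<le> C * \<epsilon>\<^sup>2 / 2 ^ k"
    unfolding C_def by (intro divide_right_mono mult_right_mono) auto
  finally have 1: "\<bar>norm (x - ctr \<omega> F) - rad F\<bar> \<le> C * \<epsilon>\<^sup>2 / 2 ^ k" .
  have "\<delta> \<le> \<epsilon>"
  proof -
    have "\<epsilon>\<^sup>2 / 2 ^ k \<le> \<epsilon> * 1 / 1"
      unfolding power2_eq_square using \<epsilon> by (intro frac_le mult_left_mono) auto
    with \<delta> show ?thesis by simp
  qed
  moreover have "norm w \<le> 2 * qsum * \<epsilon>"
  proof -
    have "(2 * \<epsilon>) * qsum / 2 ^ k \<le> (2 * \<epsilon>) * qsum / 1"
      using \<epsilon> qsum_nonneg by (intro divide_left_mono) auto
    with w(1) show ?thesis by (simp add: mult_ac)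
  qed
  moreover have "norm (rad F *\<^sub>R (\<sigma> - \<omega> k)) \<le> 6 * \<epsilon>"
  proof -
    have "norm (\<sigma> - \<omega> k) \<le> 2 * \<epsilon>" using near[of 0] by (simp add: dist_norm norm_minus_commute)
    then have "rad F * norm (\<sigma> - \<omega> k) \<le> 3 * (2 * \<epsilon>)" using r by (intro mult_mono) auto
    then show ?thesis using r by simp
  qed
  moreover have "norm (x - ctr \<omega> F - rad F *\<^sub>R \<omega> k)
      \<le> norm (x - ctr \<omega> F - z) + norm w + norm (rad F *\<^sub>R (\<sigma> - \<omega> k))"
  proof -
    have "x - ctr \<omega> F - rad F *\<^sub>R \<omega> k = (x - ctr \<omega> F - z) + w + rad F *\<^sub>R (\<sigma> - \<omega> k)"
      by (simp add: z_def algebra_simps)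
    then show ?thesis by (metis (no_types, lifting) add_mono norm_triangle_ineq norm_triangle_le order_refl)
  qed
  \<comment> \<open>Here 7 = 1 + 6, with 1 from \<delta> and 6 from a radius of at most 3 times a
    direction error of at most 2\<epsilon>; 2 \<open>qsum\<close> comes from the tail.\<close>
  ultimately have "norm (x - ctr \<omega> F - rad F *\<^sub>R \<omega> k) \<le> (7 + 2 * qsum) * \<epsilon>"
    using xz by (simp add: algebra_simps)
  also have "\<dots> \<le> C * \<epsilon>"
    unfolding C_def using \<epsilon> qsum_nonneg by (intro mult_right_mono) auto
  finally show ?thesis using 1 by (simp add: shell_cap_def)
qed

subsection \<open>Volume of the neighbourhoods\<close>

definition sphere_union :: "(nat \<Rightarrow> 'a::euclidean_space) \<Rightarrow> 'a set" where
  "sphere_union \<omega> = {x. \<exists>T. norm (x - ctr \<omega> T) = rad T}"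

lemma sphere_unionE:
  assumes "y \<in> sphere_union \<omega>"
  obtains T \<sigma> where "norm \<sigma> = 1" "y = ctr \<omega> T + rad T *\<^sub>R \<sigma>"
proof -
  from assms obtain T where T: "norm (y - ctr \<omega> T) = rad T" by (auto simp: sphere_union_def)
  have r: "rad T > 0" using rad_bounds(1)[of T] by linarith
  show ?thesis
  proof
    show "norm ((1 / rad T) *\<^sub>R (y - ctr \<omega> T)) = 1" using r by (simp add: T)
    show "y = ctr \<omega> T + rad T *\<^sub>R ((1 / rad T) *\<^sub>R (y - ctr \<omega> T))" using r by simp
  qed
qed

text \<open>The strict inequality leaves slack \<delta> - \<open>dist x y\<close>, within which a
  limit point \<open>y\<close> can be replaced by a point of \<open>S\<close>.\<close>

lemma nbhd_closure: "nbhd \<delta> (closure S) = nbhd \<delta> S"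
proof
  show "nbhd \<delta> (closure S) \<subseteq> nbhd \<delta> S"
  proof
    fix x assume "x \<in> nbhd \<delta> (closure S)"
    then obtain y where y: "y \<in> closure S" "dist x y < \<delta>" by (auto simp: nbhd_def)
    then obtain z where "z \<in> S" "dist z y < \<delta> - dist x y"
      by (meson closure_approachable diff_gt_0_iff_gt)
    then have "dist x z < \<delta>" using dist_triangle[of x z y] by (simp add: dist_commute)
    then show "x \<in> nbhd \<delta> S" using \<open>z \<in> S\<close> by (auto simp: nbhd_def)
  qed
qed (use closure_subset in \<open>auto simp: nbhd_def\<close>)

lemma sets_nbhd: "nbhd \<delta> (S :: 'a::euclidean_space set) \<in> sets lebesgue"
proof -
  have "nbhd \<delta> S = (\<Union>y\<in>S. ball y \<delta>)" by (auto simp: nbhd_def dist_commute)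
  then have "open (nbhd \<delta> S)" by auto
  then show ?thesis by (simp add: borel_open)
qed

text \<open>Centres have norm at most 2 and radii are at most 3.\<close>

lemma sphere_union_subset_ball:
  assumes "\<And>j. norm (\<omega> j) = 1"
  shows "sphere_union \<omega> \<subseteq> cball 0 5"
proof
  fix y assume "y \<in> sphere_union \<omega>"
  then obtain T where "norm (y - ctr \<omega> T) = rad T" by (auto simp: sphere_union_def)
  then show "y \<in> cball 0 5"
    using norm_ctr_le[of \<omega> T] assms rad_bounds(2)[of T] norm_triangle_ineq2[of y "ctr \<omega> T"] by simp
qed

text \<open>The direction \<sigma> of a sphere point from its centre selects an index k < N after
  which the sequence stays near \<sigma>. All digit sets agreeing below k then share one cap, so
  finitely many caps suffice.\<close>

lemma nbhd_sphere_union_cover: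
  fixes \<omega> :: "nat \<Rightarrow> 'a::euclidean_space"
  assumes \<omega>: "\<And>j. norm (\<omega> j) = 1" and \<epsilon>: "0 < \<epsilon>" "\<epsilon> \<le> 1"
    and \<delta>: "\<delta> \<le> \<epsilon>\<^sup>2 / 2 ^ N"
    and near: "\<And>\<sigma>. norm \<sigma> = 1 \<Longrightarrow> \<exists>k<N. \<forall>i. dist (\<omega> (k + i)) \<sigma> \<le> 2 * (1 + i) * \<epsilon>"
  defines "C \<equiv> 7 + 4 * qsum + 4 * qsum\<^sup>2"
  shows "nbhd \<delta> (sphere_union \<omega>) \<subseteq> (\<Union>k<N. \<Union>F\<in>Pow {..<k}.
           (+) (ctr \<omega> F) ` shell_cap (rad F) (C * \<epsilon>\<^sup>2 / 2 ^ k) (C * \<epsilon>) (\<omega> k))"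
proof
  fix x assume "x \<in> nbhd \<delta> (sphere_union \<omega>)"
  then obtain y where "y \<in> sphere_union \<omega>" and xy: "dist x y < \<delta>" by (auto simp: nbhd_def)
  then obtain T \<sigma> where \<sigma>: "norm \<sigma> = 1" and y: "y = ctr \<omega> T + rad T *\<^sub>R \<sigma>"
    by (auto elim: sphere_unionE)
  from near[OF \<sigma>] obtain k where k: "k < N" "\<And>i. dist (\<omega> (k + i)) \<sigma> \<le> 2 * (1 + i) * \<epsilon>" by auto
  have "\<epsilon>\<^sup>2 / 2 ^ N \<le> \<epsilon>\<^sup>2 / 2 ^ k"
    using k(1) by (intro divide_left_mono power_increasing) auto
  with \<delta> have "\<delta> \<le> \<epsilon>\<^sup>2 / 2 ^ k" by linarith
  define F where "F = T \<inter> {..<k}"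
  have "x - ctr \<omega> F \<in> shell_cap (rad F) (C * \<epsilon>\<^sup>2 / 2 ^ k) (C * \<epsilon>) (\<omega> k)"
    unfolding C_def F_def
    using near_sphere_in_shell_cap[OF \<omega> \<sigma> \<epsilon> \<open>\<delta> \<le> \<epsilon>\<^sup>2 / 2 ^ k\<close> k(2)] xy y by simp
  then have "x \<in> (+) (ctr \<omega> F) ` shell_cap (rad F) (C * \<epsilon>\<^sup>2 / 2 ^ k) (C * \<epsilon>) (\<omega> k)"
    by (rule rev_image_eqI) simp
  moreover have "F \<in> Pow {..<k}" by (auto simp: F_def)
  ultimately show "x \<in> (\<Union>k<N. \<Union>F\<in>Pow {..<k}.
           (+) (ctr \<omega> F) ` shell_cap (rad F) (C * \<epsilon>\<^sup>2 / 2 ^ k) (C * \<epsilon>) (\<omega> k))"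
    using k(1) by blast
qed

text \<open>For each k the 2^k digit sets cancel the factor 2^-k in the volume of a cap, so every k
  < N contributes the same amount. The constant is fixed before \<omega>, \<epsilon>, \<delta> and
  N, hence depends on the dimension only.\<close>

lemma measure_nbhd_sphere_union_le:
  obtains M :: real where "0 \<le> M"
    "\<And>\<omega> :: nat \<Rightarrow> 'a::euclidean_space. \<And>\<epsilon> \<delta> N.
      (\<And>j. norm (\<omega> j) = 1) \<Longrightarrow> 0 < \<epsilon> \<Longrightarrow> \<epsilon> \<le> 1 \<Longrightarrow> \<delta> \<le> \<epsilon>\<^sup>2 / 2 ^ N \<Longrightarrow>
      (\<And>\<sigma>. norm \<sigma> = 1 \<Longrightarrow> \<exists>k<N. \<forall>i. dist (\<omega> (k + i)) \<sigma> \<le> 2 * (1 + i) * \<epsilon>) \<Longrightarrow>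
      measure lebesgue (nbhd \<delta> (sphere_union \<omega>)) \<le> M * N * (\<epsilon>\<^sup>2 * \<epsilon> ^ (DIM('a) - 1))"
proof -
  define C where "C = 7 + 4 * qsum + 4 * qsum\<^sup>2"
  have C: "C \<ge> 1" using qsum_nonneg by (simp add: C_def)
  \<comment> \<open>The base 3 + 2 * C bounds the outer radii of all caps, as radii are at most 3
    and normal errors at most C.\<close>
  define H where "H = 3 * real DIM('a) * (3 + 2 * C) ^ (DIM('a) - 1) * 3 ^ DIM('a)
    * measure lebesgue (ball (0::'a) 1)"
  have H: "H \<ge> 0" using C by (simp add: H_def)
  show ?thesis
  proof
    show "0 \<le> H * C ^ DIM('a)" using C H by simp
    fix \<omega> :: "nat \<Rightarrow> 'a" and \<epsilon> \<delta> :: real and N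
    assume \<omega>: "\<And>j. norm (\<omega> j) = 1" and \<epsilon>: "0 < \<epsilon>" "\<epsilon> \<le> 1" and \<delta>: "\<delta> \<le> \<epsilon>\<^sup>2 / 2 ^ N"
      and near: "\<And>\<sigma>. norm \<sigma> = 1 \<Longrightarrow> \<exists>k<N. \<forall>i. dist (\<omega> (k + i)) \<sigma> \<le> 2 * (1 + i) * \<epsilon>"
    define P where "P k F = (+) (ctr \<omega> F) ` shell_cap (rad F) (C * \<epsilon>\<^sup>2 / 2 ^ k) (C * \<epsilon>) (\<omega> k)"
      for k F
    have comp: "compact (P k F)" for k F
      unfolding P_def by (intro compact_translation compact_shell_cap)
    then have meas: "P k F \<in> lmeasurable" for k F by (rule lmeasurable_compact)
    have P_le: "measure lebesgue (P k F) \<le> H * C ^ DIM('a) * (\<epsilon>\<^sup>2 * \<epsilon> ^ (DIM('a) - 1)) / 2 ^ k" for k F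
    proof -
      have le: "C * \<epsilon>\<^sup>2 / 2 ^ k \<le> C * \<epsilon>"
      proof -
        have "C * \<epsilon>\<^sup>2 / 2 ^ k \<le> C * (\<epsilon> * 1) / 1"
          unfolding power2_eq_square using \<epsilon> C by (intro frac_le mult_left_mono) auto
        then show ?thesis by simp
      qed
      moreover have "C * \<epsilon> \<le> C" using \<epsilon> C by simp
      ultimately have "rad F + 2 * (C * \<epsilon>\<^sup>2 / 2 ^ k) \<le> 3 + 2 * C"
        using rad_bounds(2)[of F] by linarith
      then have "measure lebesgue (shell_cap (rad F) (C * \<epsilon>\<^sup>2 / 2 ^ k) (C * \<epsilon>) (\<omega> k))
          \<le> H * ((C * \<epsilon>\<^sup>2 / 2 ^ k) * (C * \<epsilon>) ^ (DIM('a) - 1))"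
        unfolding H_def using \<epsilon> C le rad_bounds(1) \<omega> by (intro measure_shell_cap_le) auto
      also have "\<dots> = H * C ^ DIM('a) * (\<epsilon>\<^sup>2 * \<epsilon> ^ (DIM('a) - 1)) / 2 ^ k"
        using power_minus_mult[of "DIM('a)" C] by (simp add: power_mult_distrib mult_ac)
      finally show ?thesis by (simp add: P_def measure_translation)
    qed
    have "measure lebesgue (nbhd \<delta> (sphere_union \<omega>)) \<le> measure lebesgue (\<Union>k<N. \<Union>F\<in>Pow {..<k}. P k F)"
    proof (rule measure_mono_fmeasurable)
      show "nbhd \<delta> (sphere_union \<omega>) \<subseteq> (\<Union>k<N. \<Union>F\<in>Pow {..<k}. P k F)"
        unfolding P_def C_def by (rule nbhd_sphere_union_cover[OF \<omega> \<epsilon> \<delta> near])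
      show "(\<Union>k<N. \<Union>F\<in>Pow {..<k}. P k F) \<in> lmeasurable"
        by (intro lmeasurable_compact compact_UN comp) auto
    qed (rule sets_nbhd)
    also have "\<dots> \<le> (\<Sum>k<N. measure lebesgue (\<Union>F\<in>Pow {..<k}. P k F))"
      by (intro measure_UNION_le fmeasurableD lmeasurable_compact compact_UN comp) auto
    also have "\<dots> \<le> (\<Sum>k<N. \<Sum>F\<in>Pow {..<k}. measure lebesgue (P k F))"
      by (intro sum_mono measure_UNION_le fmeasurableD meas) auto
    also have "\<dots> \<le> (\<Sum>k<N. \<Sum>F\<in>Pow {..<k}. H * C ^ DIM('a) * (\<epsilon>\<^sup>2 * \<epsilon> ^ (DIM('a) - 1)) / 2 ^ k)"
      by (intro sum_mono P_le)
    also have "\<dots> = H * C ^ DIM('a) * N * (\<epsilon>\<^sup>2 * \<epsilon> ^ (DIM('a) - 1))"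
      by (simp add: card_Pow)
    finally show "measure lebesgue (nbhd \<delta> (sphere_union \<omega>))
      \<le> H * C ^ DIM('a) * N * (\<epsilon>\<^sup>2 * \<epsilon> ^ (DIM('a) - 1))" .
  qed
qed

section \<open>Choice of the scale and conclusion\<close>

lemma power_bracket:
  fixes b X :: real
  assumes "1 < b" "1 \<le> X"
  obtains m where "b ^ m \<le> X" "X < b ^ Suc m"
proof -
  define n where "n = (LEAST n. X < b ^ n)"
  have "\<exists>n. X < b ^ n" using assms real_arch_pow by blast
  then have n: "X < b ^ n" unfolding n_def by (rule LeastI_ex)
  then obtain m where m: "n = Suc m" using assms by (cases n) auto
  then have "\<not> X < b ^ m" using not_less_Least[of m "\<lambda>n. X < b ^ n"] by (simp add: n_def)
  with n m that[of m] show ?thesis by auto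
qed

lemma le_inverse_power2:
  fixes \<delta> :: real
  assumes "0 < \<delta>" "\<delta> < 1" "real n * ln 2 \<le> \<bar>ln \<delta>\<bar>"
  shows "\<delta> \<le> 1 / 2 ^ n"
proof -
  have "ln \<delta> \<le> ln (1 / 2 ^ n)" using assms by (simp add: ln_div ln_realpow)
  then show ?thesis using assms by (subst (asm) ln_le_cancel_iff) auto
qed

theorem mainTheorem2:
  fixes d :: nat
  assumes "d \<ge> 1" and "CARD('n::finite) = d + 1"
  shows "\<exists>(K :: (real ^ 'n) set) (C :: real).
    compact K \<and>
    (\<forall>r\<in>{1..2::real}. \<exists>c. {x. norm (x - c) = r} \<subseteq> K) \<and>
    (\<forall>\<delta>\<in>{0<..<1::real}.
       measure lebesgue (nbhd \<delta> K) \<le> C * \<bar>ln \<delta>\<bar> powr (- 2 / real d))"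
proof -
  have dim: "DIM(real ^ 'n) = d + 1" using assms(2) by simp
  obtain \<omega> :: "nat \<Rightarrow> real ^ 'n" and A0 :: real where \<omega>: "\<And>k. norm (\<omega> k) = 1" and "0 < A0" and
    \<omega>A0: "\<And>m \<sigma>. norm \<sigma> = 1 \<Longrightarrow>
       \<exists>k. k < A0 * 2 ^ (d * m) \<and> (\<forall>i. dist (\<omega> (k + i)) \<sigma> \<le> 2 * (1 + i) / 2 ^ m)"
    using sphere_sequence[OF assms(1) dim] by blast
  define A where "A = nat \<lceil>A0\<rceil>"
  have A: "\<exists>k < A * 2 ^ (d * m). \<forall>i. dist (\<omega> (k + i)) \<sigma> \<le> 2 * (1 + i) * (1 / 2 ^ m)"
    if "norm \<sigma> = 1" for m \<sigma>
  proof -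
    obtain k where k: "k < A0 * 2 ^ (d * m)" "\<forall>i. dist (\<omega> (k + i)) \<sigma> \<le> 2 * (1 + i) / 2 ^ m"
      using \<omega>A0[OF \<open>norm \<sigma> = 1\<close>, of m] by blast
    have "A0 * 2 ^ (d * m) \<le> real A * 2 ^ (d * m)"
      unfolding A_def by (intro mult_right_mono real_nat_ceiling_ge) simp
    with k(1) have "real k < real A * 2 ^ (d * m)" by linarith
    then have "real k < real (A * 2 ^ (d * m))" by simp
    then have "k < A * 2 ^ (d * m)" by (simp only: of_nat_less_iff)
    with k(2) show ?thesis by auto
  qed
  obtain M :: real where M: "0 \<le> M"
    "\<And>(\<omega> :: nat \<Rightarrow> real ^ 'n) \<epsilon> \<delta> N.
      (\<And>j. norm (\<omega> j) = 1) \<Longrightarrow> 0 < \<epsilon> \<Longrightarrow> \<epsilon> \<le> 1 \<Longrightarrow> \<delta> \<le> \<epsilon>\<^sup>2 / 2 ^ N \<Longrightarrow>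
      (\<And>\<sigma>. norm \<sigma> = 1 \<Longrightarrow> \<exists>k<N. \<forall>i. dist (\<omega> (k + i)) \<sigma> \<le> 2 * (1 + i) * \<epsilon>) \<Longrightarrow>
      measure lebesgue (nbhd \<delta> (sphere_union \<omega>)) \<le> M * N * (\<epsilon>\<^sup>2 * \<epsilon> ^ (DIM(real ^ 'n) - 1))"
    using measure_nbhd_sphere_union_le[where 'a="real ^ 'n"] by metis
  \<comment> \<open>The closure makes the set compact and leaves its open neighbourhoods
    unchanged.\<close>
  define K where "K = closure (sphere_union \<omega>)"
  \<comment> \<open>With \<epsilon> = 2^-m and N = A 2^(d m), the requirement \<delta> <=
    \<epsilon>^2 / 2^N reads (N + 2m) ln 2 <= |ln \<delta>|. As N + 2m <= (A + 2) 2^(d m), it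
    suffices that 2^(d m) c <= |ln \<delta>|.\<close>
  define c where "c = (A + 2) * ln 2"
  define \<beta> where "\<beta> = measure lebesgue (ball (0 :: real ^ 'n) 6)"
  have c: "c > 0" by (simp add: c_def)
  have "compact K"
    unfolding K_def using sphere_union_subset_ball[of \<omega>] \<omega>
    by (meson bounded_cball bounded_subset compact_closure)
  moreover have "\<exists>c. {x. norm (x - c) = r} \<subseteq> K" if "r \<in> {1..2}" for r
  proof -
    have "0 \<le> r - 1" "r - 1 < 2" using that by auto
    then obtain T where T: "dyad T sums (r - 1)" using dyad_expansion by blast
    then have "rad T = r" by (simp add: rad_def sums_iff)
    then have "{x. norm (x - ctr \<omega> T) = r} \<subseteq> sphere_union \<omega>" by (auto simp: sphere_union_def)
    then show ?thesis unfolding K_def using closure_subset by blast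
  qed
  moreover have "measure lebesgue (nbhd \<delta> K)
      \<le> (\<beta> + 4 * (M * A)) / c powr (- 2 / real d) * \<bar>ln \<delta>\<bar> powr (- 2 / real d)"
    if "\<delta> \<in> {0<..<1}" for \<delta>
  proof -
    define X where "X = \<bar>ln \<delta>\<bar> / c"
    have "ln \<delta> < 0" using that by simp
    then have X: "X > 0" unfolding X_def using c by (intro divide_pos_pos) auto
    have pos: "\<beta> \<ge> 0" "M * A \<ge> 0" using M(1) by (auto simp: \<beta>_def)
    have "measure lebesgue (nbhd \<delta> K) \<le> (\<beta> + 4 * (M * A)) * X powr (- 2 / real d)"
    \<comment> \<open>For X <= 1 the power of X is at least 1 and a fixed ball suffices; its radius
      6 is 5 plus the bound 1 on \<delta>.\<close>
    proof (cases "X \<le> 1")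
      case True
      have "measure lebesgue (nbhd \<delta> K) \<le> \<beta>"
        unfolding \<beta>_def K_def nbhd_closure
      proof (rule measure_mono_fmeasurable)
        show "nbhd \<delta> (sphere_union \<omega>) \<subseteq> ball 0 6"
        proof
          fix x assume "x \<in> nbhd \<delta> (sphere_union \<omega>)"
          then obtain y where "y \<in> sphere_union \<omega>" "dist x y < \<delta>" by (auto simp: nbhd_def)
          moreover from this have "norm y \<le> 5" using sphere_union_subset_ball[of \<omega>] \<omega> by force
          ultimately show "x \<in> ball 0 6"
            using norm_triangle_ineq2[of x y] that by (simp add: dist_norm)
        qed
      qed (auto simp: sets_nbhd)
      also have "\<dots> \<le> (\<beta> + 4 * (M * A)) * 1" using pos by simp
      also have "\<dots> \<le> (\<beta> + 4 * (M * A)) * X powr (- 2 / real d)"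
      proof (intro mult_left_mono)
        have "1 powr (- 2 / real d) \<le> X powr (- 2 / real d)"
          using True X by (intro powr_mono2') auto
        then show "1 \<le> X powr (- 2 / real d)" by simp
      qed (use pos in auto)
      finally show ?thesis .
    next
      case False
      then have "1 < (2::real) ^ d" "1 \<le> X" using assms(1) by (auto simp: one_less_power)
      \<comment> \<open>The lower bound on X makes the scale 2^-m admissible for \<delta>; the upper
        bound shows that it is optimal up to a constant.\<close>
      then obtain m where m: "(2 ^ d) ^ m \<le> X" "X < (2 ^ d) ^ Suc m"
        using power_bracket by blast
      define N where "N = A * 2 ^ (d * m)"
      have \<delta>: "\<delta> \<le> (1 / 2 ^ m)\<^sup>2 / 2 ^ N"
      proof -
        have "m \<le> 2 ^ m" by (rule less_imp_le[OF less_exp])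
        also have "\<dots> \<le> (2::nat) ^ (d * m)" using assms(1) by (intro power_increasing) auto
        finally have "N + 2 * m \<le> (A + 2) * 2 ^ (d * m)" by (simp add: N_def algebra_simps)
        then have "real (N + 2 * m) \<le> real ((A + 2) * 2 ^ (d * m))" by (simp only: of_nat_le_iff)
        then have "real (N + 2 * m) * ln 2 \<le> real ((A + 2) * 2 ^ (d * m)) * ln 2"
          by (intro mult_right_mono) auto
        also have "\<dots> = (2 ^ d) ^ m * c" by (simp add: c_def power_mult algebra_simps)
        also have "\<dots> \<le> X * c" using m(1) c by (intro mult_right_mono) auto
        also have "\<dots> = \<bar>ln \<delta>\<bar>" using c by (simp add: X_def)
        finally have "\<delta> \<le> 1 / 2 ^ (N + 2 * m)" using that by (intro le_inverse_power2) auto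
        also have "\<dots> = (1 / 2 ^ m)\<^sup>2 / 2 ^ N"
          by (simp add: power_add power_divide mult.commute flip: power_mult)
        finally show ?thesis .
      qed
      have "measure lebesgue (nbhd \<delta> K) \<le> M * N * ((1 / 2 ^ m)\<^sup>2 * (1 / 2 ^ m) ^ (DIM(real ^ 'n) - 1))"
        unfolding K_def nbhd_closure
      proof (rule M(2)[OF \<omega> _ _ \<delta>])
        show "\<exists>k<N. \<forall>i. dist (\<omega> (k + i)) \<sigma> \<le> 2 * (1 + i) * (1 / 2 ^ m)" if "norm \<sigma> = 1" for \<sigma>
          using A[OF that] by (simp add: N_def)
      qed auto
      \<comment> \<open>The factor \<epsilon>^d from the size of the caps cancels 2^(d m) in N,
        which leaves \<epsilon>^2.\<close>
      also have "\<dots> = M * A * (1 / 2 ^ m)\<^sup>2"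
      proof -
        have *: "N * (1 / 2 ^ m) ^ (DIM(real ^ 'n) - 1) = A"
          using dim by (simp add: N_def power_divide mult.commute[of m d] flip: power_mult)
        have "M * N * ((1 / 2 ^ m)\<^sup>2 * v) = M * (N * v) * (1 / 2 ^ m)\<^sup>2" for v :: real
          by simp
        from this[of "(1 / 2 ^ m) ^ (DIM(real ^ 'n) - 1)"] show ?thesis unfolding * .
      qed
      \<comment> \<open>The upper bound on X involves m + 1, which costs the factor 4.\<close>
      also have "\<dots> = (4 * (M * A)) * (1 / 4 ^ Suc m)"
      proof -
        have "(1 / 2 ^ m)\<^sup>2 = 1 / (4::real) ^ m"
          by (simp add: power_divide power2_eq_square flip: power_mult_distrib)
        then show ?thesis by simp
      qed
      also have "\<dots> \<le> (\<beta> + 4 * (M * A)) * X powr (- 2 / real d)"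
      proof (intro mult_mono)
        have "(1::real) / 4 ^ Suc m = 1 / 2 ^ (2 * Suc m)" by (simp add: power_mult)
        also have "\<dots> = 1 / 2 powr real (2 * Suc m)" by (simp only: powr_realpow zero_less_numeral)
        also have "\<dots> = 2 powr (- 2 * real (Suc m))" by (subst powr_minus_divide[symmetric]) simp
        also have "\<dots> = (2 powr (real d * real (Suc m))) powr (- 2 / real d)"
          using assms(1) by (simp add: powr_powr mult.commute)
        also have "2 powr (real d * real (Suc m)) = 2 powr real (d * Suc m)" by (simp only: of_nat_mult)
        also have "\<dots> = (2 ^ d) ^ Suc m" by (simp only: powr_realpow zero_less_numeral power_mult)
        also have "\<dots> powr (- 2 / real d) \<le> X powr (- 2 / real d)"
          using X m(2) by (intro powr_mono2') auto
        finally show "1 / 4 ^ Suc m \<le> X powr (- 2 / real d)" .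
      qed (use pos in auto)
      finally show ?thesis .
    qed
    also have "X powr (- 2 / real d) = \<bar>ln \<delta>\<bar> powr (- 2 / real d) / c powr (- 2 / real d)"
      using c by (simp add: X_def powr_divide)
    finally show ?thesis by simp
  qed
  ultimately show ?thesis by blast
qed

end
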